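(* Assume that $\alpha=\mu/k$ is a positive constant scalar (isotropic homogeneous medium; $\mu>0$ the constant viscosity and $k>0$ the constant permeability), that the body force is conservative, i.e. $\rho\mathbf{b}=-\mathrm{grad}[\psi]$ in $\Omega$ for some scalar field $\psi$, and that the response is steady-state. Let $\boldsymbol{\omega}=\mathrm{curl}[\mathbf{v}]$ denote the vorticity of a velocity field $\mathbf{v}$. (1) If $(\mathbf{v},p)$ satisfies the steady Darcy equations, in particular $$\alpha\mathbf{v}+\mathrm{grad}[p]=\rho\mathbf{b},\qquad \mathrm{div}[\mathbf{v}]=0\quad\text{in }\Omega,$$ then $\boldsymbol{\omega}=\mathbf{0}$ in $\Omega$. (2) If $(\mathbf{v},p)$ satisfies the steady Darcy–Brinkman equations, in particular $$\alpha\mathbf{v}+\mathrm{grad}[p]-\mathrm{div}[2\mu\mathbf{D}]=\rho\mathbf{b},\qquad \mathrm{div}[\mathbf{v}]=0\quad\text{in }\Omega,\qquad \mathbf{D}=\tfrac12(\mathrm{grad}[\mathbf{v}]+\mathrm{grad}[\mathbf{v}]^{\mathrm T}),$$ then $$\Delta\boldsymbol{\omega}=\frac1k\,\boldsymbol{\omega}\quad\text{in }\Omega .$$ Moreover, the vorticity satisfies the maximum principle that its non-negative maximum and non-positive minimum occur on the boundary: for each Cartesian component $\omega$ of $\boldsymbol{\omega}$ (in two dimensions, the single component $\omega_z$) with $\omega\in C^2(\Omega)\cap C^0(\overline\Omega)$, $$\max_{\mathbf{x}\in\overline\Omega}\omega(\mathbf{x})\le\max\Big[0,\max_{\mathbf{x}\in\partial\Omega}\omega(\mathbf{x})\Big],\qquad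 \min_{\mathbf{x}\in\overline\Omega}\omega(\mathbf{x})\ge\min\Big[0,\min_{\mathbf{x}\in\partial\Omega}\omega(\mathbf{x})\Big].$$
   Context: $\Omega\subset\mathbb{R}^{nd}$, $nd\in\{2,3\}$, is a bounded open domain with boundary $\partial\Omega=\overline\Omega\setminus\Omega$. In three dimensions $\mathrm{curl}[\mathbf{v}]$ is the usual curl. In two dimensions the vorticity is $\boldsymbol{\omega}(x,y)=\omega_z(x,y)\,\widehat{\mathbf{e}}_z$ with $\omega_z=\partial v_y/\partial x-\partial v_x/\partial y$, where $\widehat{\mathbf{e}}_z$ is the unit vector perpendicular to the plane, and $\Delta\boldsymbol{\omega}=(\Delta_{2\mathrm D}\,\omega_z)\widehat{\mathbf{e}}_z$. $\Delta$ is the Laplacian (applied componentwise to vectors); $\mathrm{div}$ of a tensor field is taken row-wise. $\rho$ is the fluid density, $\mathbf{b}$ the specific body force, $p$ the pressure. The fields $\mathbf{v}$, $p$, $\psi$ are assumed sufficiently smooth in $\Omega$ that all derivatives appearing, including those after taking the curl of the momentum equation, exist and are continuous (e.g. $\mathbf{v}\in C^4(\Omega)$, $p,\psi\in C^3(\Omega)$). The boundary conditions accompanying the Darcy and Darcy–Brinkman equations play no role in the conclusions and may be arbitrary. *)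

theory Defs
  imports "HOL-Analysis.Analysis"
begin

text \<open>
  \<open>C_k n S f\<close> says that \<open>f\<close> is of class \<open>C\<^sup>n\<close> on \<open>S\<close>; it is meant for open \<open>S\<close>, since the derivatives
  are taken in full neighbourhoods of the points of \<open>S\<close>. In finite dimension, continuity of all
  directional derivatives is the same as continuity of the derivative.
\<close>

primrec C_k :: "nat \<Rightarrow> 'a::real_normed_vector set \<Rightarrow> ('a \<Rightarrow> 'b::real_normed_vector) \<Rightarrow> bool" where
  "C_k 0 S f \<longleftrightarrow> continuous_on S f"
| "C_k (Suc n) S f \<longleftrightarrow>
     (\<forall>x\<in>S. f differentiable (at x)) \<and> (\<forall>h. C_k n S (\<lambda>x. frechet_derivative f (at x) h))"

definition partial_deriv :: "'n::finite \<Rightarrow> (real^'n \<Rightarrow> real) \<Rightarrow> real^'n \<Rightarrow> real" where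
  "partial_deriv i f x = frechet_derivative f (at x) (axis i 1)"

definition grad :: "(real^'n::finite \<Rightarrow> real) \<Rightarrow> real^'n \<Rightarrow> real^'n" where
  "grad f x = (\<chi> i. partial_deriv i f x)"

definition divergence :: "(real^'n::finite \<Rightarrow> real^'n) \<Rightarrow> real^'n \<Rightarrow> real" where
  "divergence v x = (\<Sum>i\<in>UNIV. partial_deriv i (\<lambda>y. v y $ i) x)"

text \<open>For \<open>T :: real^'n^'n\<close>, \<open>T $ i\<close> is the \<open>i\<close>-th row, so this is the row-wise divergence.\<close>

definition tensor_div :: "(real^'n::finite \<Rightarrow> real^'n^'n) \<Rightarrow> real^'n \<Rightarrow> real^'n" where
  "tensor_div T x = (\<chi> i. divergence (\<lambda>y. T y $ i) x)"

definition laplacian :: "(real^'n::finite \<Rightarrow> real) \<Rightarrow> real^'n \<Rightarrow> real" where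
  "laplacian f x = (\<Sum>i\<in>UNIV. partial_deriv i (partial_deriv i f) x)"

text \<open>
  The number of components may differ from the space dimension: the vorticity of a planar field is
  a function of two variables with values in three-space.
\<close>

definition vec_laplacian :: "(real^'n::finite \<Rightarrow> real^'m::finite) \<Rightarrow> real^'n \<Rightarrow> real^'m" where
  "vec_laplacian u x = (\<chi> i. laplacian (\<lambda>y. u y $ i) x)"

definition curl :: "(real^3 \<Rightarrow> real^3) \<Rightarrow> real^3 \<Rightarrow> real^3" where
  "curl v x = vector
     [partial_deriv 2 (\<lambda>y. v y $ 3) x - partial_deriv 3 (\<lambda>y. v y $ 2) x,
      partial_deriv 3 (\<lambda>y. v y $ 1) x - partial_deriv 1 (\<lambda>y. v y $ 3) x,
      partial_deriv 1 (\<lambda>y. v y $ 2) x - partial_deriv 2 (\<lambda>y. v y $ 1) x]"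

definition vorticity_z :: "(real^2 \<Rightarrow> real^2) \<Rightarrow> real^2 \<Rightarrow> real" where
  "vorticity_z v x = partial_deriv 1 (\<lambda>y. v y $ 2) x - partial_deriv 2 (\<lambda>y. v y $ 1) x"

definition curl_2D :: "(real^2 \<Rightarrow> real^2) \<Rightarrow> real^2 \<Rightarrow> real^3" where
  "curl_2D v x = vorticity_z v x *\<^sub>R axis 3 1"

definition sym_grad :: "(real^'n::finite \<Rightarrow> real^'n) \<Rightarrow> real^'n \<Rightarrow> real^'n^'n" where
  "sym_grad v x = (1/2) *\<^sub>R (jacobian v (at x) + transpose (jacobian v (at x)))"

definition conservative_body_force ::
  "(real^'n::finite) set \<Rightarrow> (real^'n \<Rightarrow> real) \<Rightarrow> (real^'n \<Rightarrow> real^'n) \<Rightarrow> (real^'n \<Rightarrow> real) \<Rightarrow> bool" where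
  "conservative_body_force \<Omega> \<rho> b \<psi> \<longleftrightarrow> (\<forall>x\<in>\<Omega>. \<rho> x *\<^sub>R b x = - grad \<psi> x)"

definition steady_darcy ::
  "(real^'n::finite) set \<Rightarrow> real \<Rightarrow> (real^'n \<Rightarrow> real) \<Rightarrow> (real^'n \<Rightarrow> real^'n) \<Rightarrow>
   (real^'n \<Rightarrow> real^'n) \<Rightarrow> (real^'n \<Rightarrow> real) \<Rightarrow> bool" where
  "steady_darcy \<Omega> \<alpha> \<rho> b v p \<longleftrightarrow>
     (\<forall>x\<in>\<Omega>. \<alpha> *\<^sub>R v x + grad p x = \<rho> x *\<^sub>R b x) \<and>
     (\<forall>x\<in>\<Omega>. divergence v x = 0)"

definition steady_darcy_brinkman ::
  "(real^'n::finite) set \<Rightarrow> real \<Rightarrow> real \<Rightarrow> (real^'n \<Rightarrow> real) \<Rightarrow> (real^'n \<Rightarrow> real^'n) \<Rightarrow>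
   (real^'n \<Rightarrow> real^'n) \<Rightarrow> (real^'n \<Rightarrow> real) \<Rightarrow> bool" where
  "steady_darcy_brinkman \<Omega> \<alpha> \<mu> \<rho> b v p \<longleftrightarrow>
     (\<forall>x\<in>\<Omega>. \<alpha> *\<^sub>R v x + grad p x - tensor_div (\<lambda>y. (2 * \<mu>) *\<^sub>R sym_grad v y) x = \<rho> x *\<^sub>R b x) \<and>
     (\<forall>x\<in>\<Omega>. divergence v x = 0)"

text \<open>
  \<open>max_principle \<Omega> f\<close> concerns a scalar field \<open>f\<close> on \<open>\<Omega>\<close> that is \<open>C\<^sup>2\<close> in \<open>\<Omega>\<close> and continuous up to
  the boundary. As only the values of \<open>f\<close> inside \<open>\<Omega>\<close> are meaningful, membership in
  \<open>C\<^sup>0(closure \<Omega>)\<close> means having a continuous extension \<open>g\<close> to the closure. For bounded nonempty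
  open \<open>\<Omega>\<close> the closure and the frontier are compact and nonempty, so the suprema and infima are
  the maxima and minima.
\<close>

definition max_principle :: "(real^'n::finite) set \<Rightarrow> (real^'n \<Rightarrow> real) \<Rightarrow> bool" where
  "max_principle \<Omega> f \<longleftrightarrow>
     (\<forall>g. C_k 2 \<Omega> g \<and> continuous_on (closure \<Omega>) g \<and> (\<forall>x\<in>\<Omega>. g x = f x) \<longrightarrow>
        (SUP x\<in>closure \<Omega>. g x) \<le> max 0 (SUP x\<in>frontier \<Omega>. g x) \<and>
        (INF x\<in>closure \<Omega>. g x) \<ge> min 0 (INF x\<in>frontier \<Omega>. g x))"

end

theory Submission
  imports Defs
begin

text \<open>
  By incompressibility \<open>div(2\<mu>D) = \<mu> \<Delta>v\<close>, so both models say that a field \<open>F\<close> is a gradient, namely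
  \<open>F = \<alpha> v\<close> (Darcy) or \<open>F = \<alpha> v - \<mu> \<Delta>v\<close> (Darcy--Brinkman). Symmetry of second derivatives gives
  \<open>\<partial>\<^sub>i F\<^sub>j = \<partial>\<^sub>j F\<^sub>i\<close>; since \<open>\<Delta>\<close> commutes with \<open>\<partial>\<^sub>i\<close>, every \<open>w = \<partial>\<^sub>i v\<^sub>j - \<partial>\<^sub>j v\<^sub>i\<close> satisfies
  \<open>\<alpha> w = 0\<close>, respectively \<open>\<alpha> w = \<mu> \<Delta>w\<close>. The zeroth-order term makes the maximum principle
  elementary: at a positive interior maximum \<open>\<Delta>w = w / k > 0\<close>, while every second partial derivative
  is non-positive there.
\<close>

section \<open>Locality and linearity of derivatives, and closure properties of the
  \<open>C_k\<close> classes\<close>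

text \<open>\<open>frechet_derivative\<close> chooses among the derivatives at a point. Functions
  that agree near \<open>x\<close> have the same derivatives there, so the choices coincide, even
  where none exists.\<close>

lemma frechet_derivative_cong_open:
  assumes "open S" "x \<in> S" "\<And>y. y \<in> S \<Longrightarrow> f y = g y"
  shows "frechet_derivative f (at x) = frechet_derivative g (at x)"
proof -
  have "(f has_derivative D) (at x) \<longleftrightarrow> (g has_derivative D) (at x)" for D
    using assms has_derivative_transform_within_open[of f D x UNIV S g]
      has_derivative_transform_within_open[of g D x UNIV S f] by auto
  then show ?thesis
    unfolding frechet_derivative_def by simp
qed

lemma differentiable_cong_open:
  assumes "open S" "x \<in> S" "\<And>y. y \<in> S \<Longrightarrow> f y = g y" "f differentiable (at x)"
  shows "g differentiable (at x)"
  using assms has_derivative_transform_within_open[of f _ x UNIV S g]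
  unfolding differentiable_def by blast

lemma partial_deriv_cong_open:
  assumes "open S" "x \<in> S" "\<And>y. y \<in> S \<Longrightarrow> f y = g y"
  shows "partial_deriv i f x = partial_deriv i g x"
  using frechet_derivative_cong_open[OF assms] by (simp add: partial_deriv_def)

lemma laplacian_cong_open:
  assumes "open S" "x \<in> S" "\<And>y. y \<in> S \<Longrightarrow> f y = g y"
  shows "laplacian f x = laplacian g x"
  unfolding laplacian_def using assms
  by (intro sum.cong refl partial_deriv_cong_open[of S]) auto

text \<open>Allows a derivative to be replaced by a formula valid only on \<open>S\<close>. The
  induction varies \<open>f\<close> and \<open>g\<close> because its step passes to their
  directional derivatives, which again agree on \<open>S\<close>.\<close>

lemma C_k_cong_open:
  assumes "open S" "\<And>y. y \<in> S \<Longrightarrow> f y = g y" "C_k n S f"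
  shows "C_k n S g"
  using assms(2,3)
proof (induction n arbitrary: f g)
  case 0
  then show ?case by (metis C_k.simps(1) continuous_on_cong)
next
  case (Suc n)
  have "C_k n S (\<lambda>x. frechet_derivative g (at x) h)" for h
  proof (rule Suc.IH)
    show "frechet_derivative f (at y) h = frechet_derivative g (at y) h" if "y \<in> S" for y
      using frechet_derivative_cong_open[OF assms(1) that Suc.prems(1)] by simp
    show "C_k n S (\<lambda>x. frechet_derivative f (at x) h)"
      using Suc.prems by simp
  qed
  then show ?case
    using Suc.prems differentiable_cong_open[OF assms(1) _ Suc.prems(1)] by auto
qed

lemma C_k_Suc_D: "C_k (Suc n) S f \<Longrightarrow> C_k n S f"
  by (induction n arbitrary: f)
    (auto intro!: continuous_at_imp_continuous_on differentiable_imp_continuous_within)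

lemma C_k_partial_deriv: "C_k (Suc n) S f \<Longrightarrow> C_k n S (partial_deriv i f)"
  unfolding partial_deriv_def[abs_def] by simp

lemma frechet_derivative_bounded_linear:
  assumes "bounded_linear L" "f differentiable (at x)"
  shows "frechet_derivative (\<lambda>y. L (f y)) (at x) = (\<lambda>h. L (frechet_derivative f (at x) h))"
  using assms bounded_linear.has_derivative[OF assms(1)]
  by (metis frechet_derivative_at frechet_derivative_works)

text \<open>One induction covers vector components, negation and the zero function, all obtained
  later by choosing \<open>L\<close>.\<close>

lemma C_k_bounded_linear:
  assumes "open S" "bounded_linear L" "C_k n S f"
  shows "C_k n S (\<lambda>x. L (f x))"
  using assms(3)
proof (induction n arbitrary: f)
  case 0
  then show ?case using assms(2) by (simp add: bounded_linear.continuous_on)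
next
  case (Suc n)
  have d: "f differentiable (at x)" if "x \<in> S" for x using Suc.prems that by simp
  have "C_k n S (\<lambda>x. frechet_derivative (\<lambda>y. L (f y)) (at x) h)" for h
    by (rule C_k_cong_open[OF assms(1) _ Suc.IH[of "\<lambda>x. frechet_derivative f (at x) h"]])
      (use Suc.prems d in \<open>auto simp: frechet_derivative_bounded_linear[OF assms(2)]\<close>)
  moreover have "(\<lambda>y. L (f y)) differentiable (at x)" if "x \<in> S" for x
    using d[OF that] bounded_linear.has_derivative[OF assms(2)] unfolding differentiable_def by blast
  ultimately show ?case by simp
qed

lemma C_k_add:
  assumes "open S" "C_k n S f" "C_k n S g"
  shows "C_k n S (\<lambda>x. f x + g x)"
  using assms(2,3)
proof (induction n arbitrary: f g)
  case 0
  then show ?case by (simp add: continuous_on_add)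
next
  case (Suc n)
  have eq: "frechet_derivative (\<lambda>y. f y + g y) (at x) h
      = frechet_derivative f (at x) h + frechet_derivative g (at x) h" if "x \<in> S" for x h
    using has_derivative_add[of f _ "at x" g] Suc.prems that
    by (metis (no_types, lifting) C_k.simps(2) frechet_derivative_at frechet_derivative_works)
  have "C_k n S (\<lambda>x. frechet_derivative (\<lambda>y. f y + g y) (at x) h)" for h
  proof (rule C_k_cong_open[OF assms(1)])
    show "C_k n S (\<lambda>x. frechet_derivative f (at x) h + frechet_derivative g (at x) h)"
      using Suc.prems by (intro Suc.IH) auto
  qed (simp add: eq)
  then show ?case using Suc.prems by simp
qed

lemma C_k_component:
  fixes v :: "'a::real_normed_vector \<Rightarrow> real^'m::finite"
  assumes "open S" "C_k n S v"
  shows "C_k n S (\<lambda>x. v x $ i)"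
  using C_k_bounded_linear[OF assms(1) bounded_linear_vec_nth assms(2)] .

lemma partial_deriv_add:
  assumes "f differentiable (at x)" "g differentiable (at x)"
  shows "partial_deriv i (\<lambda>y. f y + g y) x = partial_deriv i f x + partial_deriv i g x"
  unfolding partial_deriv_def using has_derivative_add[of f _ "at x" g] assms
  by (metis (no_types, lifting) frechet_derivative_at frechet_derivative_works)

lemma partial_deriv_diff:
  assumes "f differentiable (at x)" "g differentiable (at x)"
  shows "partial_deriv i (\<lambda>y. f y - g y) x = partial_deriv i f x - partial_deriv i g x"
  unfolding partial_deriv_def using has_derivative_diff[of f _ "at x" g] assms
  by (metis (no_types, lifting) frechet_derivative_at frechet_derivative_works)

lemma partial_deriv_cmult:
  assumes "f differentiable (at x)"
  shows "partial_deriv i (\<lambda>y. c * f y) x = c * partial_deriv i f x"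
  unfolding partial_deriv_def
  using frechet_derivative_bounded_linear[OF bounded_linear_mult_right assms] by simp

lemma partial_deriv_minus:
  assumes "f differentiable (at x)"
  shows "partial_deriv i (\<lambda>y. - f y) x = - partial_deriv i f x"
  using partial_deriv_cmult[OF assms, of i "-1"] by simp

lemma partial_deriv_sum:
  assumes "\<And>l. l \<in> A \<Longrightarrow> f l differentiable (at x)"
  shows "partial_deriv i (\<lambda>y. \<Sum>l\<in>A. f l y) x = (\<Sum>l\<in>A. partial_deriv i (f l) x)"
proof -
  have "((\<lambda>y. \<Sum>l\<in>A. f l y) has_derivative (\<lambda>h. \<Sum>l\<in>A. frechet_derivative (f l) (at x) h)) (at x)"
    by (rule has_derivative_sum) (use assms frechet_derivative_works in blast)
  from frechet_derivative_at[OF this] show ?thesis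
    unfolding partial_deriv_def by metis
qed

section \<open>Symmetry of second derivatives\<close>

text \<open>Chain rule along a line; it makes the one-variable mean value theorem and derivative
  tests available for functions on a normed space.\<close>

lemma has_real_derivative_along_line:
  fixes f :: "'a::real_normed_vector \<Rightarrow> real"
  assumes "f differentiable (at (c + s *\<^sub>R u))"
  shows "((\<lambda>s. f (c + s *\<^sub>R u)) has_real_derivative frechet_derivative f (at (c + s *\<^sub>R u)) u) (at s)"
proof -
  let ?D = "frechet_derivative f (at (c + s *\<^sub>R u))"
  have f: "(f has_derivative ?D) (at (c + s *\<^sub>R u))"
    using assms frechet_derivative_works by blast
  have "((\<lambda>s. c + s *\<^sub>R u) has_derivative (\<lambda>h. h *\<^sub>R u)) (at s)"
    by (auto intro!: derivative_eq_intros)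
  from has_derivative_compose[OF this f]
  have "((\<lambda>s. f (c + s *\<^sub>R u)) has_derivative (\<lambda>h. ?D (h *\<^sub>R u))) (at s)" .
  moreover have "?D (h *\<^sub>R u) = ?D u * h" for h
    using linear_frechet_derivative[OF assms] by (simp add: linear_cmul)
  ultimately show ?thesis
    by (simp add: has_field_derivative_def)
qed

text \<open>Two applications of the mean value theorem: first in direction \<open>u\<close> to the
  difference of \<open>f\<close> along two parallel edges, then in direction \<open>v\<close> to the
  derivative \<open>Du\<close>.\<close>

lemma second_difference_mean_value:
  fixes f :: "'a::real_normed_vector \<Rightarrow> real"
  assumes C: "C_k 2 S f" and t: "0 < t"
    and S: "\<And>a b. 0 \<le> a \<Longrightarrow> a \<le> t \<Longrightarrow> 0 \<le> b \<Longrightarrow> b \<le> t \<Longrightarrow> x + a *\<^sub>R u + b *\<^sub>R v \<in> S"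
  obtains a b where "0 < a" "a < t" "0 < b" "b < t"
    "f (x + t *\<^sub>R u + t *\<^sub>R v) - f (x + t *\<^sub>R u) - f (x + t *\<^sub>R v) + f x
      = t\<^sup>2 * frechet_derivative (\<lambda>y. frechet_derivative f (at y) u) (at (x + a *\<^sub>R u + b *\<^sub>R v)) v"
proof -
  define Du where "Du = (\<lambda>y. frechet_derivative f (at y) u)"
  have df: "f differentiable (at y)" and dDu: "Du differentiable (at y)" if "y \<in> S" for y
    using C that by (auto simp: numeral_2_eq_2 Du_def)
  \<comment> \<open>The increment of this function from \<open>0\<close> to \<open>t\<close> is the
    second difference.\<close>
  define \<phi> where "\<phi> = (\<lambda>s. f (x + t *\<^sub>R v + s *\<^sub>R u) - f (x + s *\<^sub>R u))"
  have 1: "x + t *\<^sub>R v + s *\<^sub>R u \<in> S" "x + s *\<^sub>R u \<in> S" if "0 \<le> s" "s \<le> t" for s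
    using S[of s t] S[of s 0] t that by (simp_all add: algebra_simps)
  have "(\<phi> has_real_derivative Du (x + t *\<^sub>R v + s *\<^sub>R u) - Du (x + s *\<^sub>R u)) (at s)"
    if "0 \<le> s" "s \<le> t" for s
    unfolding \<phi>_def Du_def
    by (intro DERIV_diff has_real_derivative_along_line df 1 that)
  from MVT2[OF t this] obtain a where a: "0 < a" "a < t"
    "\<phi> t - \<phi> 0 = (t - 0) * (Du (x + t *\<^sub>R v + a *\<^sub>R u) - Du (x + a *\<^sub>R u))"
    by metis
  have 2: "x + a *\<^sub>R u + s *\<^sub>R v \<in> S" if "0 \<le> s" "s \<le> t" for s
    using S[of a s] a that by simp
  have "((\<lambda>s. Du (x + a *\<^sub>R u + s *\<^sub>R v)) has_real_derivative
      frechet_derivative Du (at (x + a *\<^sub>R u + s *\<^sub>R v)) v) (at s)" if "0 \<le> s" "s \<le> t" for s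
    by (intro has_real_derivative_along_line dDu 2 that)
  from MVT2[OF t this] obtain b where b: "0 < b" "b < t"
    "Du (x + a *\<^sub>R u + t *\<^sub>R v) - Du (x + a *\<^sub>R u + 0 *\<^sub>R v)
      = (t - 0) * frechet_derivative Du (at (x + a *\<^sub>R u + b *\<^sub>R v)) v"
    by metis
  have "f (x + t *\<^sub>R u + t *\<^sub>R v) - f (x + t *\<^sub>R u) - f (x + t *\<^sub>R v) + f x = \<phi> t - \<phi> 0"
    by (simp add: \<phi>_def algebra_simps)
  also have "\<dots> = t * (Du (x + a *\<^sub>R u + t *\<^sub>R v) - Du (x + a *\<^sub>R u + 0 *\<^sub>R v))"
    using a(3) by (simp add: algebra_simps)
  also have "\<dots> = t\<^sup>2 * frechet_derivative Du (at (x + a *\<^sub>R u + b *\<^sub>R v)) v"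
    unfolding b(3) by (simp add: power2_eq_square)
  finally show ?thesis
    using that[OF a(1,2) b(1,2)] unfolding Du_def by blast
qed

text \<open>
  The second difference over a small parallelogram is symmetric in its two directions, and the mean
  value theorem expresses it through either of the two mixed derivatives.
\<close>

theorem frechet_derivative_commute:
  fixes f :: "'a::real_normed_vector \<Rightarrow> real"
  assumes "open S" "C_k 2 S f" "x \<in> S"
  shows "frechet_derivative (\<lambda>y. frechet_derivative f (at y) u) (at x) v
       = frechet_derivative (\<lambda>y. frechet_derivative f (at y) v) (at x) u"
    (is "?A x = ?B x")
proof (rule ccontr)
  assume neq: "?A x \<noteq> ?B x"
  \<comment> \<open>Half the gap: a common value within \<open>e\<close> of both \<open>?A x\<close>
    and \<open>?B x\<close> would force the gap to be less than itself.\<close>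
  define e where "e = \<bar>?A x - ?B x\<bar> / 2"
  have e: "e > 0" using neq by (simp add: e_def)
  have "continuous_on S ?A" "continuous_on S ?B"
    using assms(2) by (auto simp: numeral_2_eq_2)
  then have "isCont ?A x" "isCont ?B x"
    using assms(1,3) continuous_on_eq_continuous_at by blast+
  then obtain d1 d2 where d: "d1 > 0" "\<And>y. dist y x < d1 \<Longrightarrow> dist (?A y) (?A x) < e"
    "d2 > 0" "\<And>y. dist y x < d2 \<Longrightarrow> dist (?B y) (?B x) < e"
    using e unfolding continuous_at_eps_delta by (metis (no_types, lifting) dist_norm)
  obtain r where r: "r > 0" "ball x r \<subseteq> S"
    using assms(1,3) openE by blast
  define m where "m = min r (min d1 d2)"
  \<comment> \<open>This size keeps the whole parallelogram within distance \<open>m\<close> of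
    \<open>x\<close>; the summand 1 keeps the denominator positive when \<open>u\<close> and
    \<open>v\<close> both vanish.\<close>
  define t where "t = m / (norm u + norm v + 1)"
  have m: "m > 0" using r d by (simp add: m_def)
  then have t: "t > 0" by (simp add: t_def add_nonneg_pos)
  have near: "dist (x + a *\<^sub>R u + b *\<^sub>R v) x < m" if "0 \<le> a" "a \<le> t" "0 \<le> b" "b \<le> t" for a b
  proof -
    have "dist (x + a *\<^sub>R u + b *\<^sub>R v) x \<le> a * norm u + b * norm v"
      using norm_triangle_ineq[of "a *\<^sub>R u" "b *\<^sub>R v"] that by (simp add: dist_norm add.assoc)
    also have "\<dots> \<le> t * norm u + t * norm v"
      using that by (intro add_mono mult_right_mono) auto
    also have "\<dots> < t * (norm u + norm v + 1)"
      using t by (simp add: algebra_simps)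
    also have "\<dots> = m"
      using add_nonneg_pos[of "norm u + norm v" 1] by (simp add: t_def)
    finally show ?thesis .
  qed
  have inS: "x + a *\<^sub>R u + b *\<^sub>R v \<in> S" if "0 \<le> a" "a \<le> t" "0 \<le> b" "b \<le> t" for a b
    using near[OF that] r(2) by (auto simp: m_def dist_commute)
  obtain a b where ab: "0 < a" "a < t" "0 < b" "b < t"
    "f (x + t *\<^sub>R u + t *\<^sub>R v) - f (x + t *\<^sub>R u) - f (x + t *\<^sub>R v) + f x
      = t\<^sup>2 * ?A (x + a *\<^sub>R u + b *\<^sub>R v)"
    by (rule second_difference_mean_value[of S f t x u v, OF assms(2) t inS]) blast+
  have inS': "x + b *\<^sub>R v + a *\<^sub>R u \<in> S" if "0 \<le> b" "b \<le> t" "0 \<le> a" "a \<le> t" for a b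
    using inS[of a b] that by (simp add: algebra_simps)
  obtain b' a' where ab': "0 < b'" "b' < t" "0 < a'" "a' < t"
    "f (x + t *\<^sub>R v + t *\<^sub>R u) - f (x + t *\<^sub>R v) - f (x + t *\<^sub>R u) + f x
      = t\<^sup>2 * ?B (x + b' *\<^sub>R v + a' *\<^sub>R u)"
    by (rule second_difference_mean_value[of S f t x v u, OF assms(2) t inS']) blast+
  let ?y = "x + a *\<^sub>R u + b *\<^sub>R v" and ?z = "x + b' *\<^sub>R v + a' *\<^sub>R u"
  have "t\<^sup>2 * ?A ?y = t\<^sup>2 * ?B ?z"
    using ab(5) ab'(5) by (simp add: algebra_simps)
  then have "?A ?y = ?B ?z" using t by simp
  moreover have "dist (?A ?y) (?A x) < e"
    using d(2)[of ?y] near[of a b] ab by (simp add: m_def)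
  moreover have "dist (?B ?z) (?B x) < e"
    using d(4)[of ?z] near[of a' b'] ab' by (simp add: m_def add.assoc add.commute[of "b' *\<^sub>R v"])
  ultimately have "\<bar>?A x - ?B x\<bar> < 2 * e"
    by (simp add: dist_real_def)
  then show False by (simp add: e_def)
qed

lemma partial_deriv_commute:
  assumes "open S" "C_k 2 S f" "x \<in> S"
  shows "partial_deriv i (partial_deriv j f) x = partial_deriv j (partial_deriv i f) x"
  using frechet_derivative_commute[OF assms] unfolding partial_deriv_def[abs_def] .

section \<open>The Laplacian and the viscous term\<close>

lemma laplacian_diff:
  assumes "open S" "x \<in> S" "C_k 2 S f" "C_k 2 S g"
  shows "laplacian (\<lambda>y. f y - g y) x = laplacian f x - laplacian g x"
proof -
  have d: "f differentiable (at y)" "g differentiable (at y)" if "y \<in> S" for y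
    using assms(3,4) that by (auto simp: numeral_2_eq_2)
  have d2: "partial_deriv l f differentiable (at x)" "partial_deriv l g differentiable (at x)" for l
    using assms(2-4) C_k_partial_deriv[of 1] by (auto simp: numeral_2_eq_2)
  have "partial_deriv l (partial_deriv l (\<lambda>y. f y - g y)) x
      = partial_deriv l (\<lambda>y. partial_deriv l f y - partial_deriv l g y) x" for l
    by (rule partial_deriv_cong_open[OF assms(1,2)]) (simp add: partial_deriv_diff d)
  then show ?thesis
    by (simp add: laplacian_def partial_deriv_diff d2 sum_subtractf)
qed

text \<open>The case of \<open>laplacian_diff\<close> with minuend zero, where zero is the zero
  linear map composed with \<open>f\<close>.\<close>

lemma laplacian_minus:
  assumes "open S" "x \<in> S" "C_k 2 S f"
  shows "laplacian (\<lambda>y. - f y) x = - laplacian f x"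
  using laplacian_diff[OF assms(1,2) C_k_bounded_linear[OF assms(1) bounded_linear_zero assms(3)] assms(3)]
  by (simp add: laplacian_def partial_deriv_def[abs_def])

text \<open>In each summand \<partial>i moves past \<partial>l twice. The outer swap concerns
  \<partial>l f, which is of class C2 because \<open>f\<close> is C3; the inner one holds throughout
  \<open>S\<close> and so may be made under a derivative.\<close>

lemma partial_deriv_laplacian:
  assumes "open S" "x \<in> S" "C_k 3 S f"
  shows "laplacian f differentiable (at x)"
    and "partial_deriv i (laplacian f) x = laplacian (partial_deriv i f) x"
proof -
  have C2: "C_k 2 S f" using C_k_Suc_D[of 2 S f] assms(3) by (simp add: eval_nat_numeral)
  have C2': "C_k 2 S (partial_deriv l f)" for l
    using C_k_partial_deriv[of 2 S f] assms(3) by (simp add: eval_nat_numeral)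
  have d: "partial_deriv l (partial_deriv l f) differentiable (at x)" for l
    using C_k_partial_deriv[of 1 S "partial_deriv l f" l] C2'[of l] assms(2) by (simp add: numeral_2_eq_2)
  then show "laplacian f differentiable (at x)"
    unfolding laplacian_def[abs_def] by simp
  have "partial_deriv i (laplacian f) x = (\<Sum>l\<in>UNIV. partial_deriv i (partial_deriv l (partial_deriv l f)) x)"
    unfolding laplacian_def[abs_def] by (rule partial_deriv_sum) (rule d)
  also have "\<dots> = (\<Sum>l\<in>UNIV. partial_deriv l (partial_deriv l (partial_deriv i f)) x)"
  proof (rule sum.cong[OF refl])
    fix l
    have "partial_deriv i (partial_deriv l (partial_deriv l f)) x
        = partial_deriv l (partial_deriv i (partial_deriv l f)) x"
      by (rule partial_deriv_commute[OF assms(1) C2' assms(2)])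
    also have "\<dots> = partial_deriv l (partial_deriv l (partial_deriv i f)) x"
      by (rule partial_deriv_cong_open[OF assms(1,2)]) (rule partial_deriv_commute[OF assms(1) C2])
    finally show "partial_deriv i (partial_deriv l (partial_deriv l f)) x
        = partial_deriv l (partial_deriv l (partial_deriv i f)) x" .
  qed
  finally show "partial_deriv i (laplacian f) x = laplacian (partial_deriv i f) x"
    by (simp add: laplacian_def)
qed

text \<open>Row i of the divergence is \<mu> times the sum over j of \<partial>j \<partial>j v_i +
  \<partial>j \<partial>i v_j. After a swap of derivatives the second terms add up to \<partial>i
  (div v), which vanishes.\<close>

lemma tensor_div_sym_grad:
  fixes v :: "real^'n::finite \<Rightarrow> real^'n"
  assumes "open S" "x \<in> S" "C_k 2 S v" "\<And>y. y \<in> S \<Longrightarrow> divergence v y = 0"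
  shows "tensor_div (\<lambda>y. (2 * \<mu>) *\<^sub>R sym_grad v y) x $ i = \<mu> * laplacian (\<lambda>y. v y $ i) x"
proof -
  define w where "w = (\<lambda>i y. v y $ i)"
  have C2: "C_k 2 S (w j)" for j
    unfolding w_def by (rule C_k_component[OF assms(1,3)])
  have d: "partial_deriv l (w j) differentiable (at x)" for l j
    using C_k_partial_deriv[of 1 S "w j" l] C2[of j] assms(2) by (simp add: numeral_2_eq_2)
  have jac: "jacobian v (at y) $ i $ j = partial_deriv j (w i) y" if "y \<in> S" for y i j
  proof -
    have "v differentiable (at y)" using assms(3) that by (simp add: numeral_2_eq_2)
    from frechet_derivative_bounded_linear[OF bounded_linear_vec_nth this]
    show ?thesis by (simp add: jacobian_def matrix_def partial_deriv_def w_def)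
  qed
  have "partial_deriv j (\<lambda>y. ((2 * \<mu>) *\<^sub>R sym_grad v y) $ i $ j) x
      = \<mu> * (partial_deriv j (partial_deriv j (w i)) x + partial_deriv i (partial_deriv j (w j)) x)" for j
  proof -
    have "partial_deriv j (\<lambda>y. ((2 * \<mu>) *\<^sub>R sym_grad v y) $ i $ j) x
        = partial_deriv j (\<lambda>y. \<mu> * (partial_deriv j (w i) y + partial_deriv i (w j) y)) x"
      by (rule partial_deriv_cong_open[OF assms(1,2)])
        (simp add: sym_grad_def transpose_def jac algebra_simps)
    also have "\<dots> = \<mu> * (partial_deriv j (partial_deriv j (w i)) x + partial_deriv j (partial_deriv i (w j)) x)"
      by (simp add: partial_deriv_cmult partial_deriv_add d)
    finally show ?thesis
      by (simp add: partial_deriv_commute[OF assms(1) C2 assms(2), of j i j])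
  qed
  then have "tensor_div (\<lambda>y. (2 * \<mu>) *\<^sub>R sym_grad v y) x $ i
      = \<mu> * (laplacian (w i) x + (\<Sum>j\<in>UNIV. partial_deriv i (partial_deriv j (w j)) x))"
    by (simp add: tensor_div_def divergence_def laplacian_def sum.distrib flip: sum_distrib_left)
  also have "(\<Sum>j\<in>UNIV. partial_deriv i (partial_deriv j (w j)) x)
      = partial_deriv i (\<lambda>y. \<Sum>j\<in>UNIV. partial_deriv j (w j) y) x"
    by (rule partial_deriv_sum[symmetric]) (rule d)
  \<comment> \<open>The divergence vanishes on an open set around \<open>x\<close>, hence so does
    its derivative.\<close>
  also have "\<dots> = partial_deriv i (\<lambda>y. 0) x"
    by (rule partial_deriv_cong_open[OF assms(1,2)]) (use assms(4) in \<open>simp add: divergence_def w_def\<close>)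
  also have "\<dots> = 0" by (simp add: partial_deriv_def)
  finally show ?thesis by (simp add: w_def)
qed

section \<open>Taking the curl of the momentum equation\<close>

text \<open>On \<open>S\<close> the field \<open>F\<close> is the gradient of -(p + \<psi>), so the
  claim is symmetry of the Hessian of that potential.\<close>

lemma partial_deriv_potential:
  assumes "open S" "x \<in> S" "C_k 2 S p" "C_k 2 S \<psi>"
    and F: "\<And>y i. y \<in> S \<Longrightarrow> F i y = - partial_deriv i p y - partial_deriv i \<psi> y"
  shows "partial_deriv i (F j) x = partial_deriv j (F i) x"
proof -
  define q where "q = (\<lambda>y. - (p y + \<psi> y))"
  have q: "C_k 2 S q"
    unfolding q_def
    by (intro C_k_bounded_linear[OF assms(1) bounded_linear_minus] C_k_add assms bounded_linear_ident)
  have "F l y = partial_deriv l q y" if "y \<in> S" for l y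
  proof -
    have "p differentiable (at y)" "\<psi> differentiable (at y)"
      using assms(3,4) that by (auto simp: numeral_2_eq_2)
    then show ?thesis
      using that by (simp add: q_def F partial_deriv_minus partial_deriv_add del: minus_add_distrib)
  qed
  then have "partial_deriv i (F j) x = partial_deriv i (partial_deriv j q) x" for i j
    by (rule partial_deriv_cong_open[OF assms(1,2)])
  then show ?thesis
    using partial_deriv_commute[OF assms(1) q assms(2)] by simp
qed

text \<open>Here \<alpha> v is a gradient. Stating the result for an arbitrary pair of indices in
  any dimension covers the planar and the spatial curl at once.\<close>

lemma steady_darcy_irrotational:
  fixes v :: "real^'n::finite \<Rightarrow> real^'n"
  assumes "open \<Omega>" "C_k 2 \<Omega> p" "C_k 2 \<Omega> \<psi>" "C_k 1 \<Omega> v" "\<alpha> \<noteq> 0"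
    and "conservative_body_force \<Omega> \<rho> b \<psi>" "steady_darcy \<Omega> \<alpha> \<rho> b v p" "x \<in> \<Omega>"
  shows "partial_deriv i (\<lambda>y. v y $ j) x - partial_deriv j (\<lambda>y. v y $ i) x = 0"
proof -
  have "\<alpha> * v y $ l = - partial_deriv l p y - partial_deriv l \<psi> y" if "y \<in> \<Omega>" for l y
  proof -
    have "(\<alpha> *\<^sub>R v y + grad p y) $ l = (- grad \<psi> y) $ l"
      using assms(6,7) that by (simp add: conservative_body_force_def steady_darcy_def)
    then show ?thesis by (simp add: grad_def)
  qed
  from partial_deriv_potential[OF assms(1,8,2,3) this]
  have "partial_deriv i (\<lambda>y. \<alpha> * v y $ j) x = partial_deriv j (\<lambda>y. \<alpha> * v y $ i) x" .
  moreover have "(\<lambda>y. v y $ l) differentiable (at x)" for l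
    using C_k_component[OF assms(1,4)] assms(8) by simp
  ultimately show ?thesis
    using assms(5) by (simp add: partial_deriv_cmult)
qed

text \<open>Now \<alpha> v - \<mu> \<Delta>v is a gradient. Its curl contains third derivatives of
  \<open>v\<close>, and commuting \<Delta> with \<partial>i turns these into the Laplacian of
  \<open>w\<close>.\<close>

lemma steady_darcy_brinkman_vorticity:
  fixes v :: "real^'n::finite \<Rightarrow> real^'n"
  assumes "open \<Omega>" "C_k 2 \<Omega> p" "C_k 2 \<Omega> \<psi>" "C_k 3 \<Omega> v" "\<mu> \<noteq> 0"
    and "conservative_body_force \<Omega> \<rho> b \<psi>" "steady_darcy_brinkman \<Omega> \<alpha> \<mu> \<rho> b v p" "x \<in> \<Omega>"
  defines "w \<equiv> \<lambda>i j y. partial_deriv i (\<lambda>z. v z $ j) y - partial_deriv j (\<lambda>z. v z $ i) y"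
  shows "laplacian (w i j) x = (\<alpha> / \<mu>) * w i j x"
proof -
  let ?v = "\<lambda>l y. v y $ l"
  have C3: "C_k 3 \<Omega> (?v l)" for l
    by (rule C_k_component[OF assms(1,4)])
  have C2: "C_k 2 \<Omega> v" using C_k_Suc_D[of 2 \<Omega> v] assms(4) by (simp add: eval_nat_numeral)
  have C2': "C_k 2 \<Omega> (partial_deriv l (?v m))" for l m
    using C_k_partial_deriv[of 2 \<Omega> "?v m"] C3[of m] by (simp add: eval_nat_numeral)
  have d: "?v l differentiable (at x)" for l
    using C3[of l] assms(8) by (simp add: numeral_3_eq_3)
  have "\<alpha> * v y $ l - \<mu> * laplacian (?v l) y = - partial_deriv l p y - partial_deriv l \<psi> y"
    if y: "y \<in> \<Omega>" for l y
  proof -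
    have div: "divergence v z = 0" if "z \<in> \<Omega>" for z
      using assms(7) that by (simp add: steady_darcy_brinkman_def)
    have "(\<alpha> *\<^sub>R v y + grad p y - tensor_div (\<lambda>y. (2 * \<mu>) *\<^sub>R sym_grad v y) y) $ l = (- grad \<psi> y) $ l"
      using assms(6,7) y by (simp add: conservative_body_force_def steady_darcy_brinkman_def)
    then show ?thesis
      using tensor_div_sym_grad[OF assms(1) y C2 div, of \<mu> l] by (simp add: grad_def)
  qed
  from partial_deriv_potential[OF assms(1,8,2,3) this]
  have "partial_deriv i (\<lambda>y. \<alpha> * v y $ j - \<mu> * laplacian (?v j) y) x
      = partial_deriv j (\<lambda>y. \<alpha> * v y $ i - \<mu> * laplacian (?v i) y) x" .
  moreover have "partial_deriv l (\<lambda>y. \<alpha> * v y $ m - \<mu> * laplacian (?v m) y) x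
      = \<alpha> * partial_deriv l (?v m) x - \<mu> * laplacian (partial_deriv l (?v m)) x" for l m
    using partial_deriv_laplacian[OF assms(1,8) C3]
    by (simp add: partial_deriv_diff partial_deriv_cmult d)
  moreover have "laplacian (w i j) x
      = laplacian (partial_deriv i (?v j)) x - laplacian (partial_deriv j (?v i)) x"
    unfolding w_def by (rule laplacian_diff[OF assms(1,8) C2' C2'])
  ultimately have "\<mu> * laplacian (w i j) x = \<alpha> * w i j x"
    by (simp add: w_def right_diff_distrib)
  then show ?thesis
    using assms(5) by (simp add: nonzero_eq_divide_eq mult.commute)
qed

section \<open>The maximum principle\<close>

text \<open>Restrict \<open>g\<close> to the line through \<open>x\<close> along axis i. The first
  derivative vanishes at the maximum; were the second positive, the first would be positive just to
  the right and \<open>g\<close> would exceed its maximum.\<close>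

lemma second_partial_deriv_nonpos_at_max:
  assumes "open S" "x \<in> S" "C_k 2 S g" "\<And>y. y \<in> S \<Longrightarrow> g y \<le> g x"
  shows "partial_deriv i (partial_deriv i g) x \<le> 0"
proof (rule ccontr)
  let ?e = "axis i 1 :: real^'a"
  assume "\<not> ?thesis"
  then have pos: "partial_deriv i (partial_deriv i g) x > 0" by simp
  obtain r where r: "r > 0" "ball x r \<subseteq> S"
    using assms(1,2) openE by blast
  have inS: "x + s *\<^sub>R ?e \<in> S" if "\<bar>s\<bar> < r" for s
    using r(2) that by (auto simp: dist_norm)
  define h where "h = (\<lambda>s. g (x + s *\<^sub>R ?e))"
  define h' where "h' = (\<lambda>s. partial_deriv i g (x + s *\<^sub>R ?e))"
  have dh: "(h has_real_derivative h' s) (at s)" if "\<bar>s\<bar> < r" for s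
    unfolding h_def h'_def partial_deriv_def
    by (rule has_real_derivative_along_line) (use assms(3) inS[OF that] in \<open>simp add: numeral_2_eq_2\<close>)
  have "C_k 1 S (partial_deriv i g)"
    using C_k_partial_deriv[of 1 S g] assms(3) by (simp add: numeral_2_eq_2)
  \<comment> \<open>The base point is written with parameter 0 to fit the rule for derivatives along
    a line.\<close>
  then have "partial_deriv i g differentiable (at (x + 0 *\<^sub>R ?e))"
    using assms(2) by simp
  from has_real_derivative_along_line[OF this]
  have dh': "(h' has_real_derivative partial_deriv i (partial_deriv i g) x) (at 0)"
    unfolding h'_def by (simp add: partial_deriv_def)
  have max: "h s \<le> h 0" if "\<bar>s\<bar> < r" for s
    using assms(4) inS[OF that] by (simp add: h_def)
  have h'0: "h' 0 = 0"
    using DERIV_local_max[OF dh[of 0] r(1)] max r(1) by auto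
  obtain d where d: "d > 0" "\<And>s. 0 < s \<Longrightarrow> s < d \<Longrightarrow> h' s > 0"
    using DERIV_pos_inc_right[OF dh' pos] h'0 by auto
  \<comment> \<open>Halving puts \<open>t\<close> strictly inside both the range where
    \<open>h'\<close> is positive and the ball contained in \<open>S\<close>.\<close>
  define t where "t = min d r / 2"
  have t: "0 < t" "t < d" "t < r" using d(1) r(1) by (auto simp: t_def min_def)
  have "\<exists>z. 0 < z \<and> z < t \<and> h t - h 0 = (t - 0) * h' z"
    by (rule MVT2[OF t(1)]) (use dh t in auto)
  then obtain z where "0 < z" "z < t" "h t - h 0 = t * h' z" by auto
  then have "h t > h 0" using d(2)[of z] t by (smt (verit) mult_pos_pos)
  then show False using max[of t] t by simp
qed

text \<open>Compactness gives a maximum point \<open>z\<close> on the closure. If \<open>z\<close>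
  is interior, c g(z) = \<Delta>g(z) \<le> 0 gives g(z) \<le> 0; otherwise \<open>z\<close> lies on
  the frontier.\<close>

lemma max_principle_upper:
  fixes g :: "real^'n::finite \<Rightarrow> real"
  assumes "open \<Omega>" "bounded \<Omega>" "\<Omega> \<noteq> {}" "C_k 2 \<Omega> g" "continuous_on (closure \<Omega>) g"
    and "c > 0" "\<And>x. x \<in> \<Omega> \<Longrightarrow> laplacian g x = c * g x"
  shows "(SUP x\<in>closure \<Omega>. g x) \<le> max 0 (SUP x\<in>frontier \<Omega>. g x)"
proof -
  have cpt: "compact (closure \<Omega>)" using assms(2) by (simp add: compact_closure)
  obtain z where z: "z \<in> closure \<Omega>" "\<And>y. y \<in> closure \<Omega> \<Longrightarrow> g y \<le> g z"
    using continuous_attains_sup[OF cpt _ assms(5)] assms(3) by auto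
  have "g z \<le> max 0 (SUP x\<in>frontier \<Omega>. g x)"
  proof (cases "z \<in> \<Omega>")
    case True
    have "laplacian g z \<le> 0"
      unfolding laplacian_def
      by (intro sum_nonpos second_partial_deriv_nonpos_at_max[OF assms(1) True assms(4)] z closure_subset[THEN subsetD])
    then have "g z \<le> 0"
      using assms(6) assms(7)[OF True] by (simp add: mult_le_0_iff)
    then show ?thesis by simp
  next
    case False
    then have "z \<in> frontier \<Omega>"
      using z(1) assms(1) by (simp add: frontier_def interior_open)
    \<comment> \<open>Real suprema bound the values only of sets bounded above; the maximum
      \<open>g z\<close> supplies the bound.\<close>
    moreover have "bdd_above (g ` frontier \<Omega>)"
      using z(2) by (intro bdd_aboveI2[where M="g z"]) (auto simp: frontier_def)
    ultimately show ?thesis by (simp add: cSUP_upper max.coboundedI2)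
  qed
  moreover have "(SUP x\<in>closure \<Omega>. g x) \<le> g z"
    using z assms(3) by (intro cSUP_least) auto
  ultimately show ?thesis by simp
qed

text \<open>The equation passes from \<open>f\<close> to any extension \<open>g\<close>, since both
  agree on the open set. The bound from below is the bound from above for \<open>- g\<close>, which
  solves the same linear equation.\<close>

lemma max_principle_if_laplacian_eq:
  fixes f :: "real^'n::finite \<Rightarrow> real"
  assumes "open \<Omega>" "bounded \<Omega>" "\<Omega> \<noteq> {}" "c > 0" "\<And>x. x \<in> \<Omega> \<Longrightarrow> laplacian f x = c * f x"
  shows "max_principle \<Omega> f"
  unfolding max_principle_def
proof (intro allI impI)
  fix g assume "C_k 2 \<Omega> g \<and> continuous_on (closure \<Omega>) g \<and> (\<forall>x\<in>\<Omega>. g x = f x)"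
  then have g: "C_k 2 \<Omega> g" "continuous_on (closure \<Omega>) g" "\<And>x. x \<in> \<Omega> \<Longrightarrow> g x = f x" by auto
  have lap: "laplacian g x = c * g x" if "x \<in> \<Omega>" for x
    using laplacian_cong_open[OF assms(1) that g(3)] assms(5)[OF that] g(3)[OF that] by simp
  have "(SUP x\<in>closure \<Omega>. - g x) \<le> max 0 (SUP x\<in>frontier \<Omega>. - g x)"
    by (rule max_principle_upper[OF assms(1-3) _ _ assms(4)])
      (use g C_k_bounded_linear[OF assms(1) bounded_linear_minus[OF bounded_linear_ident] g(1)]
        laplacian_minus[OF assms(1) _ g(1)] lap in \<open>auto intro: continuous_on_minus\<close>)
  then have "min 0 (INF x\<in>frontier \<Omega>. g x) \<le> (INF x\<in>closure \<Omega>. g x)"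
    \<comment> \<open>A real infimum is by definition minus the supremum of the negated set.\<close>
    by (simp add: Inf_real_def image_image min_def max_def split: if_splits)
  then show "(SUP x\<in>closure \<Omega>. g x) \<le> max 0 (SUP x\<in>frontier \<Omega>. g x) \<and>
      min 0 (INF x\<in>frontier \<Omega>. g x) \<le> (INF x\<in>closure \<Omega>. g x)"
    using max_principle_upper[OF assms(1-3) g(1,2) assms(4) lap] by simp
qed

section \<open>Specialisation to planar and spatial flows\<close>

text \<open>The regularity matches what the curl of the momentum equation differentiates:
  \<open>p\<close> and \<psi> twice, \<open>v\<close> once for Darcy and three times for
  Darcy--Brinkman.\<close>

theorem theorem4:
  fixes \<mu> k \<alpha> :: real
  assumes "\<mu> > 0" and "k > 0" and "\<alpha> = \<mu> / k"
  shows
    "(\<forall>(\<Omega> :: (real^2) set) \<rho> b \<psi> v p.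
        open \<Omega> \<and> bounded \<Omega> \<and> \<Omega> \<noteq> {} \<and> C_k 2 \<Omega> p \<and> C_k 2 \<Omega> \<psi> \<and>
        conservative_body_force \<Omega> \<rho> b \<psi> \<longrightarrow>
          (C_k 1 \<Omega> v \<and> steady_darcy \<Omega> \<alpha> \<rho> b v p \<longrightarrow>
             (\<forall>x\<in>\<Omega>. curl_2D v x = 0)) \<and>
          (C_k 3 \<Omega> v \<and> steady_darcy_brinkman \<Omega> \<alpha> \<mu> \<rho> b v p \<longrightarrow>
             (\<forall>x\<in>\<Omega>. vec_laplacian (curl_2D v) x = (1 / k) *\<^sub>R curl_2D v x) \<and>
             max_principle \<Omega> (vorticity_z v)))
     \<and>
     (\<forall>(\<Omega> :: (real^3) set) \<rho> b \<psi> v p.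
        open \<Omega> \<and> bounded \<Omega> \<and> \<Omega> \<noteq> {} \<and> C_k 2 \<Omega> p \<and> C_k 2 \<Omega> \<psi> \<and>
        conservative_body_force \<Omega> \<rho> b \<psi> \<longrightarrow>
          (C_k 1 \<Omega> v \<and> steady_darcy \<Omega> \<alpha> \<rho> b v p \<longrightarrow>
             (\<forall>x\<in>\<Omega>. curl v x = 0)) \<and>
          (C_k 3 \<Omega> v \<and> steady_darcy_brinkman \<Omega> \<alpha> \<mu> \<rho> b v p \<longrightarrow>
             (\<forall>x\<in>\<Omega>. vec_laplacian (curl v) x = (1 / k) *\<^sub>R curl v x) \<and>
             (\<forall>i. max_principle \<Omega> (\<lambda>x. curl v x $ i))))"
proof (intro conjI allI impI; (elim conjE)?)
  have c: "1 / k > 0" "\<alpha> \<noteq> 0" "\<mu> \<noteq> 0" "\<alpha> / \<mu> = 1 / k"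
    using assms by auto
  {
    fix \<Omega> :: "(real^2) set" and \<rho> \<psi> p :: "real^2 \<Rightarrow> real" and b v :: "real^2 \<Rightarrow> real^2"
    assume \<Omega>: "open \<Omega>" "bounded \<Omega>" "\<Omega> \<noteq> {}" and p: "C_k 2 \<Omega> p" "C_k 2 \<Omega> \<psi>"
      and b: "conservative_body_force \<Omega> \<rho> b \<psi>"
    {
      assume v: "C_k 1 \<Omega> v" "steady_darcy \<Omega> \<alpha> \<rho> b v p"
      show "\<forall>x\<in>\<Omega>. curl_2D v x = 0"
        using steady_darcy_irrotational[OF \<Omega>(1) p v(1) c(2) b v(2)]
        by (simp add: curl_2D_def vorticity_z_def)
    }
    assume v: "C_k 3 \<Omega> v" "steady_darcy_brinkman \<Omega> \<alpha> \<mu> \<rho> b v p"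
    have lap: "laplacian (vorticity_z v) x = (1 / k) * vorticity_z v x" if "x \<in> \<Omega>" for x
      using steady_darcy_brinkman_vorticity[OF \<Omega>(1) p v(1) c(3) b v(2) that, of 1 2] c(4)
      by (simp add: vorticity_z_def[abs_def])
    then show "max_principle \<Omega> (vorticity_z v)"
      by (rule max_principle_if_laplacian_eq[OF \<Omega> c(1)])
    have "laplacian (\<lambda>y. curl_2D v y $ i) x = (1 / k) * curl_2D v x $ i" if "x \<in> \<Omega>" for x i
    \<comment> \<open>Only the third component carries \<open>vorticity_z\<close>; the others are
      identically zero, and so are their Laplacians.\<close>
    proof (cases "i = 3")
      case True
      then show ?thesis using lap[OF that] by (simp add: curl_2D_def axis_def)
    next
      case False
      then show ?thesis
        by (simp add: curl_2D_def axis_def laplacian_def partial_deriv_def[abs_def])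
    qed
    then show "\<forall>x\<in>\<Omega>. vec_laplacian (curl_2D v) x = (1 / k) *\<^sub>R curl_2D v x"
      by (simp add: vec_eq_iff vec_laplacian_def)
  }
  {
    fix \<Omega> :: "(real^3) set" and \<rho> \<psi> p :: "real^3 \<Rightarrow> real" and b v :: "real^3 \<Rightarrow> real^3"
    assume \<Omega>: "open \<Omega>" "bounded \<Omega>" "\<Omega> \<noteq> {}" and p: "C_k 2 \<Omega> p" "C_k 2 \<Omega> \<psi>"
      and b: "conservative_body_force \<Omega> \<rho> b \<psi>"
    {
      assume v: "C_k 1 \<Omega> v" "steady_darcy \<Omega> \<alpha> \<rho> b v p"
      show "\<forall>x\<in>\<Omega>. curl v x = 0"
        using steady_darcy_irrotational[OF \<Omega>(1) p v(1) c(2) b v(2)]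
        by (simp add: curl_def vec_eq_iff forall_3)
    }
    assume v: "C_k 3 \<Omega> v" "steady_darcy_brinkman \<Omega> \<alpha> \<mu> \<rho> b v p"
    \<comment> \<open>The three components of the curl belong to the index pairs (2,3), (3,1) and
      (1,2).\<close>
    have lap: "laplacian (\<lambda>y. curl v y $ i) x = (1 / k) * curl v x $ i" if "x \<in> \<Omega>" for x i
      using steady_darcy_brinkman_vorticity[OF \<Omega>(1) p v(1) c(3) b v(2) that] c(4) exhaust_3[of i]
      by (auto simp: curl_def[abs_def])
    then show "max_principle \<Omega> (\<lambda>x. curl v x $ i)" for i
      by (rule max_principle_if_laplacian_eq[OF \<Omega> c(1)])
    show "\<forall>x\<in>\<Omega>. vec_laplacian (curl v) x = (1 / k) *\<^sub>R curl v x"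
      using lap by (simp add: vec_eq_iff vec_laplacian_def)
  }
qed

end
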